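(* Let $m$ be a positive integer. If $h\in\mathcal{C}(I^m)$, then for each $\epsilon>0$ the ball $B_\epsilon(h)$ of radius $\epsilon$ around $h$ in $\mathcal{C}(I^m)$ contains a map $f$ having no (even discontinuous) iterative square root on $I^m$, i.e. such that there is no map $g:I^m\to I^m$, continuous or not, with $g\circ g=f$. In particular, $\mathcal{W}(2;I^m)$ does not contain any ball of $\mathcal{C}(I^m)$.
   Context: $I=[0,1]$ and $I^m=\{(x_1,\dots,x_m)\in\mathbb{R}^m: x_i\in I \text{ for } 1\le i\le m\}$, with the metric induced by the norm $\|(x_1,\dots,x_m)\|_\infty=\max\{|x_i|:1\le i\le m\}$. $\mathcal{C}(I^m)$ is the space of all continuous self-maps of $I^m$ with the supremum metric $\rho(f,g)=\sup\{\|f(x)-g(x)\|_\infty: x\in I^m\}$, and $B_\epsilon(h)=\{f\in\mathcal{C}(I^m):\rho(f,h)<\epsilon\}$. $\mathcal{W}(2;I^m)=\{g\circ g: g\in\mathcal{C}(I^m)\}$. *)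

theory Defs
  imports "HOL-Analysis.Analysis" "HOL-Library.FuncSet"
begin

definition unit_cube :: "(real ^ 'n) set"
  where "unit_cube = {x. \<forall>i. x $ i \<in> {0..1}}"

text \<open>
  Self-maps of the cube are represented by extensional functions (value
  \<^const>\<open>undefined\<close> off the cube), so that HOL equality is equality of maps on the cube and
  composition is \<^const>\<open>compose\<close>. Continuity refers to the product topology of
  \<^typ>\<open>real ^ 'n\<close>, which is also the topology of the maximum norm \<^const>\<open>infnorm\<close>.
\<close>

definition cube_maps :: "(real ^ 'n \<Rightarrow> real ^ 'n) set"
  where "cube_maps = unit_cube \<rightarrow>\<^sub>E unit_cube"

definition continuous_cube_maps :: "(real ^ 'n::finite \<Rightarrow> real ^ 'n) set"
  where "continuous_cube_maps = {f \<in> cube_maps. continuous_on unit_cube f}"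

definition sup_dist :: "(real ^ 'n::finite \<Rightarrow> real ^ 'n) \<Rightarrow> (real ^ 'n \<Rightarrow> real ^ 'n) \<Rightarrow> real"
  where "sup_dist f g = (SUP x\<in>unit_cube. infnorm (f x - g x))"

definition map_ball :: "(real ^ 'n::finite \<Rightarrow> real ^ 'n) \<Rightarrow> real \<Rightarrow> (real ^ 'n \<Rightarrow> real ^ 'n) set"
  where "map_ball h \<epsilon> = {f \<in> continuous_cube_maps. sup_dist f h < \<epsilon>}"

definition continuous_squares :: "(real ^ 'n::finite \<Rightarrow> real ^ 'n) set"
  where "continuous_squares = {compose unit_cube g g | g. g \<in> continuous_cube_maps}"

end

theory Submission
  imports Defs
begin

text \<open>
  Suppose \<open>x0\<close> is not fixed by \<open>f\<close>, all fibres of \<open>f\<close> except \<open>A = f\<^sup>-\<^sup>1(x0)\<close> are finite, and \<open>A\<close>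
  contains infinitely many values of \<open>f\<close>. If \<open>f = g \<circ> g\<close>, then \<open>g\<close> sends \<open>A\<close> into the finite fibre
  over \<open>g x0 \<noteq> x0\<close>, hence sends \<open>f\<^sup>-\<^sup>1(A)\<close> into a finite set, so \<open>f(f\<^sup>-\<^sup>1(A))\<close>, the set of values of
  \<open>f\<close> in \<open>A\<close>, is finite: a contradiction.

  To find such an \<open>f\<close> near \<open>h\<close>, approximate \<open>h\<close> by a polynomial map and add \<open>\<eta> x\<^sub>i\<^sup>N\<close> to the \<open>i\<close>-th
  component, with \<open>\<eta>\<close> small and \<open>N\<close> larger than all degrees. The resulting map \<open>P\<close> has finite fibres
  and finitely many fixed points, so \<open>P(P(P b)) \<noteq> P(P b)\<close> for some interior point \<open>b\<close>. Let
  \<open>f = P \<circ> c\<close>, where \<open>c\<close> shrinks a small ball around \<open>a = P b\<close> to its centre and is injective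
  outside of it. Then \<open>x0 = P a\<close> is as required, since \<open>P\<close> maps points near \<open>b\<close> into that ball.
\<close>

section \<open>A purely set-theoretic obstruction to square roots\<close>

lemma no_square_root_if_large_fibre:
  assumes gX: "g \<in> X \<rightarrow> X" and gg: "\<And>x. x \<in> X \<Longrightarrow> g (g x) = f x"
    and x0: "x0 \<in> X" "f x0 \<noteq> x0"
    and small: "\<And>y. y \<noteq> x0 \<Longrightarrow> finite {x \<in> X. f x = y}"
    and large: "infinite {y \<in> f ` X. f y = x0}"
  shows False
proof -
  define A where "A = {x \<in> X. f x = x0}"
  define B where "B = {x \<in> X. f x \<in> A}"
  define W where "W = {x \<in> X. f x \<in> g ` A}"
  have gX': "g x \<in> X" if "x \<in> X" for x using gX that by auto
  have comm: "f (g x) = g (f x)" if "x \<in> X" for x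
    using gg[OF that] gg[OF gX'[OF that]] by simp
  have "g x0 \<noteq> x0" using gg x0 by force
  moreover have "g ` A \<subseteq> {x \<in> X. f x = g x0}" using gX' comm by (auto simp: A_def)
  ultimately have finA: "finite (g ` A)" using small finite_subset by blast
  \<comment> \<open>This keeps the one possibly infinite fibre, the one over \<open>x0\<close>, out
    of \<open>W\<close>, so that \<open>W\<close> is a finite union of finite fibres.\<close>
  have "x0 \<notin> g ` A"
  proof
    assume "x0 \<in> g ` A"
    then obtain a where "a \<in> X" "f a = x0" "x0 = g a" by (auto simp: A_def)
    then show False using gg[of a] \<open>g x0 \<noteq> x0\<close> by simp
  qed
  moreover have "W = (\<Union>y\<in>g ` A. {x \<in> X. f x = y})" by (auto simp: W_def)
  ultimately have "finite W" using finA small by (metis (no_types, lifting) finite_UN_I)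
  moreover have "g ` B \<subseteq> W" using gX' comm by (auto simp: B_def W_def)
  ultimately have "finite (g ` g ` B)" by (meson finite_imageI finite_subset)
  moreover have "{y \<in> f ` X. f y = x0} \<subseteq> g ` g ` B"
  proof
    fix y assume "y \<in> {y \<in> f ` X. f y = x0}"
    then obtain x where x: "x \<in> X" "y = f x" "f y = x0" by auto
    moreover have "f x \<in> X" using x(1) gX' gg by metis
    ultimately have "x \<in> B" by (simp add: A_def B_def)
    then show "y \<in> g ` g ` B" using x gg[of x] by (metis imageI)
  qed
  ultimately show False using large finite_subset by blast
qed

section \<open>Homogeneous linear systems\<close>

text \<open>Gaussian elimination: an equation with a nonzero coefficient is solved for one unknown
  and substituted into the others, so equations and unknowns both drop by one.\<close>

lemma underdetermined_system:
  fixes v :: "'e \<Rightarrow> 's \<Rightarrow> real"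
  assumes "finite E" "finite S" "card E < card S"
  shows "\<exists>w. (\<exists>s\<in>S. w s \<noteq> 0) \<and> (\<forall>e\<in>E. (\<Sum>s\<in>S. w s * v e s) = 0)"
  using assms
proof (induction E arbitrary: S v rule: finite_induct)
  case empty
  then obtain s where "s \<in> S" by fastforce
  then show ?case by (intro exI[of _ "\<lambda>_. 1"]) auto
next
  case (insert e E)
  show ?case
  proof (cases "\<forall>s\<in>S. v e s = 0")
    case True
    have "card E < card S" using insert by simp
    from insert.IH[OF insert.prems(1) this, of v] obtain w
      where "\<exists>s\<in>S. w s \<noteq> 0" "\<forall>e\<in>E. (\<Sum>s\<in>S. w s * v e s) = 0" by auto
    moreover from True have "(\<Sum>s\<in>S. w s * v e s) = 0" by simp
    ultimately show ?thesis by (intro exI[of _ w]) simp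
  next
    case False
    then obtain s0 where s0: "s0 \<in> S" "v e s0 \<noteq> 0" by blast
    define S' where "S' = S - {s0}"
    have S': "finite S'" "s0 \<notin> S'" "S = insert s0 S'" using s0 insert.prems by (auto simp: S'_def)
    have "card E < card S'" using insert S' by auto
    \<comment> \<open>These are the coefficients after the unknown at \<open>s0\<close> has been
      eliminated by equation \<open>e\<close>; \<open>- t\<close> below is the value that
      \<open>e\<close> then forces at \<open>s0\<close>.\<close>
    from insert.IH[OF S'(1) this, of "\<lambda>e' s. v e' s - v e s / v e s0 * v e' s0"]
    obtain w where w: "\<exists>s\<in>S'. w s \<noteq> 0"
      "\<And>e'. e' \<in> E \<Longrightarrow> (\<Sum>s\<in>S'. w s * (v e' s - v e s / v e s0 * v e' s0)) = 0"
      by blast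
    define t where "t = (\<Sum>s\<in>S'. w s * v e s) / v e s0"
    define w' where "w' = w(s0 := - t)"
    have sum: "(\<Sum>s\<in>S. w' s * v e' s) = (\<Sum>s\<in>S'. w s * v e' s) - t * v e' s0" for e'
    proof -
      have "(\<Sum>s\<in>S'. w' s * v e' s) = (\<Sum>s\<in>S'. w s * v e' s)"
        by (rule sum.cong) (use S' in \<open>auto simp: w'_def\<close>)
      then show ?thesis using S' by (simp add: w'_def)
    qed
    have "(\<Sum>s\<in>S'. w s * v e' s) - t * v e' s0 = 0" if "e' \<in> E" for e'
    proof -
      have "t * v e' s0 = (\<Sum>s\<in>S'. w s * (v e s / v e s0 * v e' s0))"
        by (simp add: t_def sum_divide_distrib sum_distrib_right mult.assoc)
      then show ?thesis using w(2)[OF that] by (simp add: right_diff_distrib sum_subtractf)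
    qed
    moreover have "(\<Sum>s\<in>S'. w s * v e s) - t * v e s0 = 0" using s0 by (simp add: t_def)
    moreover have "\<exists>s\<in>S. w' s \<noteq> 0" using w(1) S' by (auto simp: w'_def)
    ultimately show ?thesis using sum by (intro exI[of _ w']) auto
  qed
qed

section \<open>Polynomial functions of bounded total degree\<close>

text \<open>Products enter only through single coordinates, so an induction over this predicate can
  absorb one coordinate at a time into a monomial.\<close>

inductive poly_deg_le :: "nat \<Rightarrow> (real ^ 'n \<Rightarrow> real) \<Rightarrow> bool" where
  const: "poly_deg_le d (\<lambda>x. c)"
| coord: "poly_deg_le d q \<Longrightarrow> poly_deg_le (Suc d) (\<lambda>x. x $ i * q x)"
| add: "poly_deg_le d q \<Longrightarrow> poly_deg_le d r \<Longrightarrow> poly_deg_le d (\<lambda>x. q x + r x)"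

lemma poly_deg_le_mono: "poly_deg_le d q \<Longrightarrow> d \<le> e \<Longrightarrow> poly_deg_le e q"
proof (induction arbitrary: e rule: poly_deg_le.induct)
  case (coord d q i)
  then obtain e' where "e = Suc e'" "d \<le> e'" by (metis Suc_le_D Suc_le_mono)
  then show ?case using coord poly_deg_le.coord by blast
qed (auto intro: poly_deg_le.intros)

lemma poly_deg_le_cmult: "poly_deg_le d q \<Longrightarrow> poly_deg_le d (\<lambda>x. c * q x)"
proof (induction rule: poly_deg_le.induct)
  case (coord d q i)
  then show ?case using poly_deg_le.coord[of d "\<lambda>x. c * q x" i] by (simp add: algebra_simps)
qed (auto intro: poly_deg_le.intros simp: distrib_left)

lemma poly_deg_le_mult:
  "poly_deg_le d q \<Longrightarrow> poly_deg_le e r \<Longrightarrow> poly_deg_le (d + e) (\<lambda>x. q x * r x)"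
proof (induction rule: poly_deg_le.induct)
  case (const d c)
  then show ?case using poly_deg_le_cmult poly_deg_le_mono by (metis le_add2)
next
  case (coord d q i)
  then show ?case using poly_deg_le.coord[of "d + e" "\<lambda>x. q x * r x" i] by (simp add: mult.assoc)
next
  case (add d q s)
  then show ?case using poly_deg_le.add by (simp add: distrib_right)
qed

lemma poly_deg_le_coord: "poly_deg_le (Suc 0) (\<lambda>x. x $ i)"
  using poly_deg_le.coord[OF poly_deg_le.const[of 0 1], of i] by simp

lemma poly_deg_le_sum:
  "finite I \<Longrightarrow> (\<And>i. i \<in> I \<Longrightarrow> poly_deg_le d (q i)) \<Longrightarrow> poly_deg_le d (\<lambda>x. \<Sum>i\<in>I. q i x)"
  by (induction I rule: finite_induct) (auto intro: poly_deg_le.intros)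

lemma real_polynomial_function_imp_poly_deg_le:
  fixes q :: "real ^ 'n::finite \<Rightarrow> real"
  shows "real_polynomial_function q \<Longrightarrow> \<exists>d. poly_deg_le d q"
proof (induction rule: real_polynomial_function.induct)
  case (linear q)
  then interpret bounded_linear q .
  define c where "c i = q (axis i 1)" for i
  have "q x = (\<Sum>i\<in>UNIV. c i * x $ i)" for x
  proof -
    have "q x = q (\<Sum>i\<in>UNIV. x $ i *\<^sub>R axis i 1)"
      using basis_expansion[of x] by (simp add: scalar_mult_eq_scaleR)
    also have "\<dots> = (\<Sum>i\<in>UNIV. c i * x $ i)" by (simp add: sum scaleR mult.commute c_def)
    finally show ?thesis .
  qed
  then have "q = (\<lambda>x. \<Sum>i\<in>UNIV. c i * x $ i)" by (rule ext)
  then have "poly_deg_le (Suc 0) q"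
    by (rule ssubst) (intro poly_deg_le_sum poly_deg_le_cmult poly_deg_le_coord, simp)
  then show ?case ..
next
  case (add f g)
  then obtain d e where "poly_deg_le d f" "poly_deg_le e g" by blast
  then have "poly_deg_le (max d e) f" "poly_deg_le (max d e) g"
    by (meson poly_deg_le_mono max.cobounded1 max.cobounded2)+
  then show ?case using poly_deg_le.add by blast
qed (use poly_deg_le.const poly_deg_le_mult in blast)+

section \<open>Monomials and finiteness of solution sets\<close>

definition monomial :: "('n::finite \<Rightarrow> nat) \<Rightarrow> real ^ 'n \<Rightarrow> real"
  where "monomial a x = (\<Prod>i\<in>UNIV. x $ i ^ a i)"

lemma monomial_update: "monomial (a(i := a i + k)) x = x $ i ^ k * monomial a x"
proof -
  have "monomial (a(i := a i + k)) x = x $ i ^ (a i + k) * (\<Prod>j\<in>UNIV - {i}. x $ j ^ a j)"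
    unfolding monomial_def by (subst prod.remove[of _ i]) (auto intro!: prod.cong)
  then show ?thesis
    unfolding monomial_def by (subst prod.remove[of _ i]) (auto simp: power_add)
qed

lemma degree_update: "(\<Sum>j\<in>UNIV. (a(i := a i + k)) j) = (\<Sum>j\<in>UNIV. a j) + (k::nat)"
  for a :: "'n::finite \<Rightarrow> nat"
proof -
  have "(\<Sum>j\<in>UNIV. (a(i := a i + k)) j) = a i + k + (\<Sum>j\<in>UNIV - {i}. a j)"
    by (subst sum.remove[of _ i]) (auto intro!: sum.cong)
  then show ?thesis by (subst sum.remove[of _ i]) auto
qed

text \<open>By linearity, the weights \<open>w\<close> annihilate every polynomial of degree below
  \<open>n\<close> once they annihilate the monomials. The factor \<open>monomial a\<close> is
  carried along so that the induction can move each coordinate factor of \<open>q\<close> into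
  it.\<close>

lemma functional_vanishes_below_degree:
  fixes q :: "real ^ 'n::finite \<Rightarrow> real"
  assumes "poly_deg_le d q"
    and "\<And>a. (\<Sum>i\<in>UNIV. a i) < n \<Longrightarrow> (\<Sum>s\<in>S. w s * monomial a s) = 0"
    and "(\<Sum>i\<in>UNIV. a i) + d < n"
  shows "(\<Sum>s\<in>S. w s * (monomial a s * q s)) = 0"
  using assms(1,3)
proof (induction arbitrary: a rule: poly_deg_le.induct)
  case (const d c)
  then have "(\<Sum>s\<in>S. w s * monomial a s) * c = 0" using assms(2)[of a] by simp
  then show ?case by (simp add: sum_distrib_right mult.assoc)
next
  case (coord d q i)
  have "(\<Sum>s\<in>S. w s * (monomial (a(i := a i + 1)) s * q s)) = 0"
    by (rule coord.IH) (use coord.prems degree_update[of a i 1] in simp)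
  then show ?case by (simp only: monomial_update power_one_right mult_ac)
next
  case (add d q r)
  then show ?case by (simp add: distrib_left sum.distrib)
qed

text \<open>
  Modulo the equations every monomial reduces to monomials with all exponents below \<open>N\<close>, so at
  most \<open>N ^ CARD('n)\<close> evaluation functionals at solutions can be linearly independent.
\<close>
lemma finite_solutions:
  fixes q :: "'n::finite \<Rightarrow> real ^ 'n \<Rightarrow> real"
  assumes q: "\<And>i. poly_deg_le d (q i)" and N: "d < N"
  shows "finite {x. \<forall>i. x $ i ^ N = q i x}"
proof (rule ccontr)
  define E where "E = {a :: 'n \<Rightarrow> nat. \<forall>i. a i < N}"
  have "E = PiE UNIV (\<lambda>_. {..<N})" by (auto simp: E_def PiE_def Pi_def)
  then have "finite E" by (simp add: finite_PiE)
  assume "infinite {x. \<forall>i. x $ i ^ N = q i x}"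
  from infinite_arbitrarily_large[OF this, of "Suc (card E)"]
  obtain S where S: "finite S" "card S = Suc (card E)" "\<And>s i. s \<in> S \<Longrightarrow> s $ i ^ N = q i s"
    by auto
  obtain w s0 where s0: "s0 \<in> S" "w s0 \<noteq> 0"
    and w: "\<And>a. a \<in> E \<Longrightarrow> (\<Sum>s\<in>S. w s * monomial a s) = 0"
    using underdetermined_system[OF \<open>finite E\<close> S(1), of monomial] S(2) by auto
  have zero: "(\<Sum>s\<in>S. w s * monomial a s) = 0" if "(\<Sum>i\<in>UNIV. a i) = n" for a n
    using that
  proof (induction n arbitrary: a rule: less_induct)
    case (less n)
    show ?case
    proof (cases "a \<in> E")
      case False
      then obtain i where i: "a i \<ge> N" by (auto simp: E_def not_less)
      \<comment> \<open>On \<open>S\<close> the factor \<open>x $ i ^ N\<close> split off here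
        equals \<open>q i\<close>, whose degree is at most \<open>d < N\<close>, so the total degree
        drops and the induction hypothesis applies.\<close>
      define b where "b = a(i := a i - N)"
      have a: "a = b(i := b i + N)" using i by (auto simp: b_def)
      have "(\<Sum>j\<in>UNIV. b j) + d < n"
        using degree_update[of b i N] less.prems N by (simp flip: a)
      then have "(\<Sum>s\<in>S. w s * (monomial b s * q i s)) = 0"
        using functional_vanishes_below_degree[OF q] less.IH by blast
      moreover have "monomial a s = monomial b s * q i s" if "s \<in> S" for s
        using monomial_update[of b i N s] S(3)[OF that] by (simp flip: a)
      ultimately show ?thesis by simp
    qed (rule w)
  qed
  \<comment> \<open>A polynomial vanishing on \<open>S\<close> except at \<open>s0\<close>. The
    weights annihilate all polynomials, yet their value on \<open>p\<close> is
    \<open>w s0 * p s0\<close>, which is nonzero.\<close>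
  define p where "p x = (\<Prod>s\<in>S - {s0}. (x - s) \<bullet> (x - s))" for x
  have "real_polynomial_function p"
    unfolding p_def
  proof (rule real_polynomial_function_prod)
    fix s
    have "real_polynomial_function (\<lambda>x. x $ i - s $ i)" for i
      by (intro real_polynomial_function_diff real_polynomial_function.intros(1,2)
        bounded_linear_vec_nth)
    then show "real_polynomial_function (\<lambda>x. (x - s) \<bullet> (x - s))"
      unfolding inner_vec_def inner_real_def vector_minus_component
      by (intro real_polynomial_function_sum real_polynomial_function.intros(4)) simp_all
  qed (simp add: S)
  then obtain e where "poly_deg_le e p"
    using real_polynomial_function_imp_poly_deg_le by blast
  from functional_vanishes_below_degree[OF this, where n = "Suc e" and S = S and w = w and a = "\<lambda>_. 0"]
  have "(\<Sum>s\<in>S. w s * p s) = 0" using zero by (simp add: monomial_def)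
  moreover have "(\<Sum>s\<in>S. w s * p s) = w s0 * p s0"
  proof -
    have "p s = 0" if "s \<in> S - {s0}" for s using that S(1) by (auto simp: p_def)
    then show ?thesis using S(1) s0(1) by (simp add: sum.remove[of S s0])
  qed
  moreover have "p s0 \<noteq> 0" using S(1) by (auto simp: p_def)
  ultimately show False using s0 by simp
qed

section \<open>Approximation by polynomial maps with finite fibres\<close>

lemma unit_cube_eq_cbox: "unit_cube = cbox 0 (1 :: real ^ 'n::finite)"
  by (auto simp: unit_cube_def mem_box_cart)

text \<open>After division by \<open>\<eta>\<close>, both \<open>P x = y\<close> and
  \<open>P x = x\<close> become systems to which \<open>finite_solutions\<close> applies.\<close>

lemma approx_with_finite_fibres:
  fixes h :: "real ^ 'n::finite \<Rightarrow> real ^ 'n"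
  assumes h: "continuous_on unit_cube h" "h \<in> unit_cube \<rightarrow> unit_cube" and e: "e > 0"
  obtains P where "continuous_on UNIV P" "P \<in> unit_cube \<rightarrow> unit_cube"
    "\<And>x i. x \<in> unit_cube \<Longrightarrow> \<bar>P x $ i - h x $ i\<bar> < e"
    "\<And>y. finite {x. P x = y}" "finite {x. P x = x}"
proof -
  define \<eta> where "\<eta> = min (1/4) (e/6)"
  have \<eta>: "\<eta> > 0" "\<eta> \<le> 1/4" "6 * \<eta> \<le> e" using e by (auto simp: \<eta>_def)
  have "\<exists>p. real_polynomial_function p \<and> (\<forall>x\<in>unit_cube. \<bar>h x $ i - p x\<bar> < \<eta>)" for i
    using Stone_Weierstrass_real_polynomial_function[of unit_cube "\<lambda>x. h x $ i" \<eta>] h(1) \<eta>(1)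
    by (metis compact_cbox continuous_on_component unit_cube_eq_cbox)
  then obtain p where p: "\<And>i. real_polynomial_function (p i)"
    and hp: "\<And>i x. x \<in> unit_cube \<Longrightarrow> \<bar>h x $ i - p i x\<bar> < \<eta>" by metis
  obtain d where d: "\<And>i. poly_deg_le (d i) (p i)"
    using real_polynomial_function_imp_poly_deg_le[OF p] by metis
  \<comment> \<open>The \<open>Suc\<close> ensures \<open>D \<ge> 1\<close>, so that the coordinates
    in the fixed point equation also have degree at most \<open>D\<close>.\<close>
  define D where "D = Suc (\<Sum>i\<in>UNIV. d i)"
  have "d i \<le> D" for i using member_le_sum[of i UNIV d] by (simp add: D_def)
  then have pD: "poly_deg_le D (p i)" for i using d poly_deg_le_mono by blast
  \<comment> \<open>This sends the range \<open>[-\<eta>, 1 + \<eta>]\<close> of \<open>p i\<close>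
    on the cube into \<open>[\<eta>, 1 - \<eta>]\<close>, leaving room for the added term, which
    lies in \<open>[0, \<eta>]\<close> there.\<close>
  define q where "q i x = (1 - 4 * \<eta>) * p i x + 2 * \<eta>" for i x
  define P where "P x = (\<chi> i. q i x + \<eta> * x $ i ^ Suc D)" for x
  have "isCont (p i) x" for i x using continuous_real_polymonial_function[OF p] .
  then have contP: "continuous_on UNIV P"
    unfolding P_def q_def
    by (intro continuous_on_vec_lambda continuous_intros) (simp add: continuous_at_imp_continuous_on)
  have close: "P x $ i \<in> {0..1} \<and> \<bar>P x $ i - h x $ i\<bar> < e" if x: "x \<in> unit_cube" for x i
  proof -
    define s t where "s = p i x" and "t = x $ i ^ Suc D"
    have "0 \<le> t" "t \<le> 1" using x by (auto simp: t_def unit_cube_def power_le_one simp del: power_Suc)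
    then have t: "0 \<le> \<eta> * t" "\<eta> * t \<le> \<eta>" using \<eta> by auto
    have "0 \<le> h x $ i" "h x $ i \<le> 1" using x h(2) by (auto simp: unit_cube_def)
    then have s: "- \<eta> \<le> s" "s \<le> 1 + \<eta>" and hs: "\<bar>h x $ i - s\<bar> < \<eta>"
      using hp[OF x, of i] by (auto simp: s_def)
    have "\<eta> * s \<le> \<eta> * (1 + \<eta>)" "\<eta> * (- \<eta>) \<le> \<eta> * s"
      using s \<eta> by (intro mult_left_mono; simp)+
    then have "\<eta> * s \<le> \<eta> + \<eta> * \<eta>" "- (\<eta> * \<eta>) \<le> \<eta> * s" by (simp_all add: algebra_simps)
    moreover have "0 \<le> \<eta> * \<eta>" by simp
    moreover have "\<eta> * \<eta> \<le> \<eta> * (1/4)" using \<eta> by (intro mult_left_mono) auto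
    moreover have "(1 - 4 * \<eta>) * s \<le> (1 - 4 * \<eta>) * (1 + \<eta>)" "(1 - 4 * \<eta>) * (- \<eta>) \<le> (1 - 4 * \<eta>) * s"
      using s \<eta> by (intro mult_left_mono; simp)+
    then have "s - 4 * (\<eta> * s) \<le> 1 - 3 * \<eta> - 4 * (\<eta> * \<eta>)" "4 * (\<eta> * \<eta>) - \<eta> \<le> s - 4 * (\<eta> * s)"
      by (simp_all add: algebra_simps)
    moreover have "P x $ i = s - 4 * (\<eta> * s) + 2 * \<eta> + \<eta> * t"
      by (simp add: P_def q_def s_def t_def algebra_simps)
    ultimately show ?thesis unfolding atLeastAtMost_iff abs_less_iff using t hs \<eta> by linarith
  qed
  \<comment> \<open>One family for both systems: \<open>b = 0\<close> gives the fibre over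
    \<open>y\<close>, while \<open>b = 1\<close> with \<open>y = 0\<close> gives the fixed
    points.\<close>
  define r where "r b y i x = (1 / \<eta>) * (y i + (b * x $ i + (4 * \<eta> - 1) * p i x + - 2 * \<eta>))"
    for b i x and y :: "'n \<Rightarrow> real"
  have deg: "poly_deg_le D (r b y i)" for b y i
  proof -
    have "poly_deg_le D (\<lambda>x. x $ i)" by (rule poly_deg_le_mono[OF poly_deg_le_coord]) (simp add: D_def)
    then show ?thesis unfolding r_def
      by (intro poly_deg_le_cmult poly_deg_le.add poly_deg_le.const pD)
  qed
  have fin: "finite {x. \<forall>i. x $ i ^ Suc D = r b y i x}" for b y
    by (rule finite_solutions[OF deg]) simp
  have eq: "x $ i ^ Suc D = r b y i x \<longleftrightarrow> P x $ i = y i + b * x $ i" for b y i x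
    using \<eta>(1) by (auto simp: P_def q_def r_def field_simps)
  show thesis
  proof (rule that[OF contP])
    show "P \<in> unit_cube \<rightarrow> unit_cube" using close by (auto simp: unit_cube_def)
    show "\<bar>P x $ i - h x $ i\<bar> < e" if "x \<in> unit_cube" for x i using close that by blast
    show "finite {x. P x = y}" for y using fin[of 0 "\<lambda>i. y $ i"] by (simp add: eq vec_eq_iff del: power_Suc)
    show "finite {x. P x = x}" using fin[of 1 "\<lambda>i. 0"] by (simp add: eq vec_eq_iff del: power_Suc)
  qed
qed

section \<open>Radial collapse of a ball to its centre\<close>

text \<open>Along each ray from \<open>a\<close>, distance \<open>n\<close> becomes
  \<open>max 0 (n - r)\<close>. The \<open>max\<close> in the denominator keeps it positive at
  \<open>a\<close>, which makes continuity immediate.\<close>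

definition collapse :: "'a::real_normed_vector \<Rightarrow> real \<Rightarrow> 'a \<Rightarrow> 'a"
  where "collapse a r x = a + (max 0 (norm (x - a) - r) / max r (norm (x - a))) *\<^sub>R (x - a)"

context
  fixes a :: "'a::real_normed_vector" and r :: real
  assumes r: "r > 0"
begin

lemma continuous_on_collapse: "continuous_on S (collapse a r)"
  unfolding collapse_def using r by (intro continuous_intros) (auto simp: max_def)

lemma collapse_inside: "norm (x - a) \<le> r \<Longrightarrow> collapse a r x = a"
  by (simp add: collapse_def)

lemma collapse_outside:
  "r \<le> norm (x - a) \<Longrightarrow> collapse a r x = a + (1 - r / norm (x - a)) *\<^sub>R (x - a)"
  using r by (auto simp: collapse_def diff_divide_distrib)

lemma norm_collapse_diff_le: "norm (collapse a r x - x) \<le> r"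
proof (cases "norm (x - a) \<le> r")
  case True
  then show ?thesis by (simp add: collapse_inside norm_minus_commute)
next
  case False
  then have "collapse a r x - x = - (r / norm (x - a)) *\<^sub>R (x - a)"
    by (simp add: collapse_outside algebra_simps)
  moreover have "x \<noteq> a" using False r by auto
  ultimately show ?thesis using r by simp
qed

text \<open>A point at distance \<open>n > 0\<close> from \<open>a\<close> can only come from
  distance \<open>n + r\<close> on the same ray.\<close>

lemma collapse_eq_iff:
  assumes "z \<noteq> a"
  shows "collapse a r x = z \<longleftrightarrow> x = a + (1 + r / norm (z - a)) *\<^sub>R (z - a)"
proof
  assume z: "collapse a r x = z"
  define n where "n = norm (x - a)"
  have n: "n > r" using z assms collapse_inside[of x] by (force simp: n_def)
  have za: "z - a = (1 - r / n) *\<^sub>R (x - a)" using z n collapse_outside[of x] by (auto simp: n_def)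
  have "norm (z - a) = \<bar>1 - r / n\<bar> * n" unfolding za by (simp add: n_def)
  also have "\<dots> = n - r" using n r by (simp add: abs_if field_simps)
  finally have "norm (z - a) = n - r" .
  then have "(1 + r / norm (z - a)) * (1 - r / n) = (1 + r / (n - r)) * (1 - r / n)" by simp
  also have "\<dots> = 1" using n r by (simp add: field_simps)
  finally have "(1 + r / norm (z - a)) * (1 - r / n) = 1" .
  then show "x = a + (1 + r / norm (z - a)) *\<^sub>R (z - a)" unfolding za scaleR_scaleR by simp
next
  define n where "n = norm (z - a)"
  have n: "n > 0" using assms by (simp add: n_def)
  assume x: "x = a + (1 + r / norm (z - a)) *\<^sub>R (z - a)"
  then have xa: "x - a = (1 + r / n) *\<^sub>R (z - a)" by (simp add: n_def)
  have "norm (x - a) = \<bar>1 + r / n\<bar> * n" unfolding xa by (simp add: n_def)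
  also have "\<dots> = n + r" using n r by (simp add: abs_if field_simps)
  finally have nx: "norm (x - a) = n + r" .
  have "1 - r / (n + r) = n / (n + r)" "1 + r / n = (n + r) / n" using n r by (simp_all add: field_simps)
  then have "(1 - r / (n + r)) * (1 + r / n) = 1" using n r by simp
  then show "collapse a r x = z" using collapse_outside[of x] n r
    by (simp add: nx) (simp add: xa)
qed

lemma collapse_in_convex:
  assumes "convex S" "a \<in> S" "x \<in> S"
  shows "collapse a r x \<in> S"
proof -
  define t where "t = max 0 (norm (x - a) - r) / max r (norm (x - a))"
  have t: "0 \<le> t" "t \<le> 1" using r by (auto simp: t_def max_def divide_le_eq)
  have "collapse a r x = (1 - t) *\<^sub>R a + t *\<^sub>R x"
    by (simp add: collapse_def t_def algebra_simps)
  then show ?thesis using assms t by (simp add: convexD)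
qed

end

section \<open>Construction of the map without square root\<close>

lemma infinite_image_if_finite_fibres:
  assumes "infinite V" "\<And>y. finite {x. P x = y}"
  shows "infinite (P ` V)"
proof
  assume "finite (P ` V)"
  from inf_img_fin_domE[OF this assms(1)] obtain y where "infinite (P -` {y})" .
  then show False using assms(2)[of y] by (simp add: vimage_def)
qed

lemma infnorm_le_if_components_le:
  fixes x :: "real ^ 'n::finite"
  assumes "\<And>i. \<bar>x $ i\<bar> \<le> e"
  shows "infnorm x \<le> e"
  unfolding infnorm_cart using assms by (intro cSup_least) auto

lemma exists_rootless_near:
  fixes h :: "real ^ 'n::finite \<Rightarrow> real ^ 'n"
  assumes h: "h \<in> continuous_cube_maps" and e: "\<epsilon> > 0"
  shows "\<exists>f \<in> map_ball h \<epsilon>. \<not> (\<exists>g \<in> cube_maps. compose unit_cube g g = f)"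
proof -
  have hc: "continuous_on unit_cube h" "h \<in> unit_cube \<rightarrow> unit_cube"
    using h by (auto simp: continuous_cube_maps_def cube_maps_def)
  obtain P where contP: "continuous_on UNIV P" and Pcube: "P \<in> unit_cube \<rightarrow> unit_cube"
    and Ph: "\<And>x i. x \<in> unit_cube \<Longrightarrow> \<bar>P x $ i - h x $ i\<bar> < \<epsilon> / 4"
    and fibres: "\<And>y. finite {x. P x = y}" and fixed: "finite {x. P x = x}"
    by (rule approx_with_finite_fibres[OF hc, of "\<epsilon> / 4"]) (use e in auto)
  have Pc: "P x \<in> unit_cube" if "x \<in> unit_cube" for x using that Pcube by auto
  define U where "U = box 0 (1 :: real ^ 'n)"
  have U: "open U" "U \<subseteq> unit_cube" by (auto simp: U_def unit_cube_eq_cbox box_subset_cbox)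
  have "(\<chi> i. 1/2) \<in> U" by (simp add: U_def mem_box_cart)
  then have "infinite U" using U(1) by (metis empty_iff finite_imp_not_open)
  moreover have "finite {b. P (P b) \<in> {x. P x = x}}"
  proof -
    have fin: "finite {b. P b \<in> F}" if "finite F" for F
    proof -
      have "{b. P b \<in> F} = (\<Union>y\<in>F. {b. P b = y})" by auto
      then show ?thesis using that fibres by simp
    qed
    show ?thesis using fin[OF fin[OF fixed]] by simp
  qed
  ultimately obtain b where b: "b \<in> U" "P (P (P b)) \<noteq> P (P b)"
    by (metis (mono_tags, lifting) finite_subset mem_Collect_eq subsetI)
  define a where "a = P b"
  define x0 where "x0 = P a"
  have ac: "a \<in> unit_cube" and x0c: "x0 \<in> unit_cube" and Px0: "P x0 \<noteq> x0"
    using b U(2) Pc by (auto simp: a_def x0_def)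
  obtain R where R: "R > 0" "ball b R \<subseteq> unit_cube" using U b openE by (metis subset_trans)
  \<comment> \<open>The first bound keeps \<open>f\<close> in the ball around \<open>h\<close>; the
    second prevents \<open>f x0 = x0\<close>.\<close>
  define \<epsilon>' where "\<epsilon>' = min (\<epsilon> / 4) (dist (P x0) x0)"
  have e': "\<epsilon>' > 0" using e Px0 by (simp add: \<epsilon>'_def)
  have "uniformly_continuous_on unit_cube P"
    using contP by (simp add: compact_uniformly_continuous continuous_on_subset unit_cube_eq_cbox)
  then obtain \<delta> where \<delta>: "\<delta> > 0"
    "\<And>x y. x \<in> unit_cube \<Longrightarrow> y \<in> unit_cube \<Longrightarrow> dist x y < \<delta> \<Longrightarrow> dist (P x) (P y) < \<epsilon>'"
    using e' unfolding uniformly_continuous_on_def by metis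
  \<comment> \<open>A point within \<open>r\<close> of \<open>b\<close> has its preimage under
    \<open>c\<close> at most \<open>r\<close> further away; \<open>2 * r \<le> R\<close> keeps that
    preimage in the cube.\<close>
  define r where "r = min (R / 2) (\<delta> / 2)"
  have r: "r > 0" "2 * r \<le> R" "r < \<delta>" using R \<delta> by (auto simp: r_def)
  define c where "c = collapse a r"
  have cc: "c x \<in> unit_cube" if "x \<in> unit_cube" for x
    unfolding c_def using collapse_in_convex[OF r(1) _ ac that] by (simp add: unit_cube_eq_cbox)
  have Pcx: "dist (P (c x)) (P x) < \<epsilon>'" if "x \<in> unit_cube" for x
    using \<delta>(2)[OF cc[OF that] that] norm_collapse_diff_le[OF r(1), of a x] r
    by (simp add: c_def dist_norm)
  define f where "f = restrict (P \<circ> c) unit_cube"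
  have f: "f x = P (c x)" if "x \<in> unit_cube" for x using that by (simp add: f_def)
  have "continuous_on unit_cube (P \<circ> c)"
    using contP continuous_on_collapse[OF r(1)] unfolding c_def
    by (intro continuous_on_compose) (auto intro: continuous_on_subset)
  then have "continuous_on unit_cube f" using f by (simp cong: continuous_on_cong)
  then have fC: "f \<in> continuous_cube_maps"
    using cc Pc by (auto simp: continuous_cube_maps_def cube_maps_def f_def)
  have "infnorm (f x - h x) \<le> \<epsilon> / 2" if x: "x \<in> unit_cube" for x
  proof (rule infnorm_le_if_components_le)
    fix i
    have "\<bar>(P (c x) - P x) $ i\<bar> \<le> \<epsilon> / 4"
      using component_le_norm_cart[of "P (c x) - P x" i] Pcx[OF x] by (simp add: dist_norm \<epsilon>'_def)
    then show "\<bar>(f x - h x) $ i\<bar> \<le> \<epsilon> / 2" 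
      using Ph[OF x, of i] unfolding f[OF x] vector_minus_component by linarith
  qed
  then have "sup_dist f h \<le> \<epsilon> / 2" unfolding sup_dist_def using ac by (intro cSUP_least) auto
  then have "f \<in> map_ball h \<epsilon>" using fC e by (simp add: map_ball_def)
  moreover have False if g: "g \<in> cube_maps" "compose unit_cube g g = f" for g
  proof (rule no_square_root_if_large_fibre)
    show "g \<in> unit_cube \<rightarrow> unit_cube" using g(1) by (auto simp: cube_maps_def)
    show "g (g x) = f x" if "x \<in> unit_cube" for x
      using g(2) that by (metis compose_eq)
    show "x0 \<in> unit_cube" by (rule x0c)
    show "f x0 \<noteq> x0" using Pcx[OF x0c] f[OF x0c] by (auto simp: \<epsilon>'_def dist_commute)
    show "finite {x \<in> unit_cube. f x = y}" if "y \<noteq> x0" for y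
    proof (rule finite_subset)
      show "{x \<in> unit_cube. f x = y} \<subseteq> (\<Union>z\<in>{z. P z = y}. {x. c x = z})" using f by auto
      have "finite {x. c x = z}" if "P z = y" for z
      proof -
        \<comment> \<open>Only the fibre of \<open>c\<close> over \<open>a\<close> contains a whole
          ball, and \<open>P a = x0\<close>; every other fibre of \<open>c\<close> is a single
          point.\<close>
        have "z \<noteq> a" using that \<open>y \<noteq> x0\<close> by (auto simp: x0_def)
        then show ?thesis by (simp add: c_def collapse_eq_iff[OF r(1)])
      qed
      then show "finite (\<Union>z\<in>{z. P z = y}. {x. c x = z})" using fibres by simp
    qed
    have "isCont P b" using contP by (simp add: continuous_on_eq_continuous_at)
    then obtain s where s: "s > 0" "\<And>z. dist z b < s \<Longrightarrow> dist (P z) a < r"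
      using r(1) unfolding continuous_at_eps_delta a_def by metis
    \<comment> \<open>Radius \<open>s\<close> puts \<open>P z\<close> into the ball that
      \<open>c\<close> collapses, so \<open>f (P z) = P a = x0\<close>. Radius \<open>r\<close> and
      the removal of \<open>a\<close> give \<open>z = c x\<close> with \<open>x\<close> in the cube,
      so \<open>P z = f x\<close> is a value of \<open>f\<close>.\<close>
    define V where "V = ball b (min s r) - {a}"
    have "infinite (ball b (min s r))"
      using s r by (metis centre_in_ball empty_iff finite_imp_not_open min_less_iff_conj open_ball)
    then have "infinite V" by (simp add: V_def)
    then have "infinite (P ` V)" using fibres by (rule infinite_image_if_finite_fibres)
    moreover have "P ` V \<subseteq> {y \<in> f ` unit_cube. f y = x0}"
    proof clarify
      fix z assume "z \<in> V"
      then have z: "dist b z < s" "dist b z < r" "z \<noteq> a" by (auto simp: V_def)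
      have "z \<in> ball b R" using z r by simp
      then have zc: "z \<in> unit_cube" using R by blast
      define x where "x = a + (1 + r / norm (z - a)) *\<^sub>R (z - a)"
      have cx: "c x = z" unfolding c_def collapse_eq_iff[OF r(1) z(3)] x_def ..
      have "dist z x \<le> r" using norm_collapse_diff_le[OF r(1), of a x] cx by (simp add: c_def dist_norm)
      then have "x \<in> ball b R" using z r dist_triangle[of b x z] by simp
      then have xc: "x \<in> unit_cube" using R by blast
      have "norm (P z - a) \<le> r" using s(2)[of z] z by (simp add: dist_norm dist_commute norm_minus_commute)
      then have "c (P z) = a" unfolding c_def by (rule collapse_inside[OF r(1)])
      then show "P z \<in> f ` unit_cube \<and> f (P z) = x0"
        using f[OF xc] f[OF Pc[OF zc]] cx xc by (metis imageI x0_def)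
    qed
    ultimately show "infinite {y \<in> f ` unit_cube. f y = x0}" using finite_subset by blast
  qed
  ultimately show ?thesis by blast
qed

theorem theorem3p8:
  shows "(\<forall>h \<in> (continuous_cube_maps :: (real ^ 'n::finite \<Rightarrow> real ^ 'n) set). \<forall>\<epsilon>>0.
            \<exists>f \<in> map_ball h \<epsilon>. \<not> (\<exists>g \<in> cube_maps. compose unit_cube g g = f))
       \<and> (\<forall>h \<in> (continuous_cube_maps :: (real ^ 'n \<Rightarrow> real ^ 'n) set). \<forall>\<epsilon>>0.
            \<not> map_ball h \<epsilon> \<subseteq> continuous_squares)"
proof (intro conjI ballI allI impI)
  fix h :: "real ^ 'n \<Rightarrow> real ^ 'n" and \<epsilon> :: real
  assume h: "h \<in> continuous_cube_maps" and e: "\<epsilon> > 0"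
  show "\<exists>f \<in> map_ball h \<epsilon>. \<not> (\<exists>g \<in> cube_maps. compose unit_cube g g = f)"
    using exists_rootless_near[OF h e] .
  show "\<not> map_ball h \<epsilon> \<subseteq> continuous_squares"
    using exists_rootless_near[OF h e]
    by (fastforce simp: continuous_squares_def continuous_cube_maps_def)
qed

end
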